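(* Let $\mu>0$, $\theta>\mu$ and $\sigma^2>0$. Put $\tau=(\theta^2+\sigma^2)/\theta$. The random variable $X_0$ with values $0$ and $\tau$ such that $\mathbb{P}\{X_0=\tau\}=\theta/\tau$ and $\mathbb{P}\{X_0=0\}=1-\theta/\tau$ satisfies $\mathbf{E}(X_0)=\theta$ and $\mathrm{Var}(X_0)=\sigma^2$. Furthermore, for $0\le c<1$ let $$\lambda_0(c)=\mathbf{E}\left(\log((1-c)+cX_0/\mu)\right)=\left(1-\frac{\theta}{\tau}\right)\log(1-c)+\frac{\theta}{\tau}\log(1-c+c\tau/\mu).$$ Then $\lambda_0$ attains its maximum over $[0,1)$ at $c_0=(\theta-\mu)/(\tau-\mu)$, and the maximum value is $$\left(1-\frac{\theta}{\tau}\right)\log\left(\frac{\tau-\theta}{\tau-\mu}\right)+\frac{\theta}{\tau}\log\left(\frac{\theta}{\mu}\right)=D_{\mathrm{KL}}\left(\mathcal{B}(\theta/\tau)\,\|\,\mathcal{B}(\mu/\tau)\right).$$ Let $X$ be a random variable with $X\ge0$ a.s., $\mathbf{E}(X)=\theta$ and $\mathrm{Var}(X)\le\sigma^2$, and for $0\le c<1$ let $\lambda(c)=\mathbf{E}(\log((1-c)+cX/\mu))$. Then $\lambda(c)\ge\lambda_0(c)$ for all $0\le c<1$, and any $c_{\mathrm{opt}}\in[0,1)$ at which $\lambda$ attains its maximum over $[0,1)$ satisfies $c_{\mathrm{opt}}\ge c_0$.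
   Context: For $0\le\nu\le1$, $\mathcal{B}(\nu)$ denotes the Bernoulli distribution on $\{0,1\}$ with probability $\nu$ of the value $1$. $D_{\mathrm{KL}}(P\|Q)$ denotes the Kullback-Leibler divergence from $Q$ to $P$, i.e. $\sum_x P(x)\log(P(x)/Q(x))$ for discrete distributions, with natural logarithm. *)

theory Defs
  imports "HOL-Probability.Probability"
begin

definition log_growth :: "'a measure \<Rightarrow> ('a \<Rightarrow> real) \<Rightarrow> real \<Rightarrow> real \<Rightarrow> real" where
  "log_growth M X \<mu> c = prob_space.expectation M (\<lambda>\<omega>. ln ((1 - c) + c * X \<omega> / \<mu>))"

(* The expectation above always exists in the intended setting, so the convention
   that the Bochner integral of a non-integrable function is 0 plays no role. *)
lemma log_growth_integrable:
  fixes X :: "'a \<Rightarrow> real" and \<mu> c :: real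
  assumes "prob_space M" and X: "integrable M X" and nonneg: "AE \<omega> in M. X \<omega> \<ge> 0"
    and \<mu>: "\<mu> > 0" and c: "0 \<le> c" "c < 1"
  shows "integrable M (\<lambda>\<omega>. ln ((1 - c) + c * X \<omega> / \<mu>))"
proof -
  interpret prob_space M by fact
  have [measurable]: "X \<in> borel_measurable M" using X by auto
  have "integrable M (\<lambda>\<omega>. \<bar>ln (1 - c)\<bar> + c * \<bar>X \<omega>\<bar> / \<mu>)"
    using X by (auto intro!: Bochner_Integration.integrable_add)
  moreover have "AE \<omega> in M. norm (ln ((1 - c) + c * X \<omega> / \<mu>))
      \<le> norm (\<bar>ln (1 - c)\<bar> + c * \<bar>X \<omega>\<bar> / \<mu>)"
    using nonneg
  proof eventually_elim
    case (elim \<omega>)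
    let ?y = "c * X \<omega> / \<mu>"
    have y: "?y \<ge> 0" using elim \<mu> c by simp
    have lo: "ln (1 - c) \<le> ln ((1 - c) + ?y)" using y c by (subst ln_le_cancel_iff) auto
    have "ln ((1 - c) + ?y) \<le> (1 - c) + ?y - 1" using y c by (intro ln_le_minus_one) auto
    then have hi: "ln ((1 - c) + ?y) \<le> ?y" using c by linarith
    have "norm (ln ((1 - c) + ?y)) \<le> \<bar>ln (1 - c)\<bar> + ?y" using lo hi y by auto
    moreover have "c * \<bar>X \<omega>\<bar> / \<mu> = ?y" using elim by simp
    ultimately show ?case by (metis abs_ge_self order_trans real_norm_def)
  qed
  moreover have "(\<lambda>\<omega>. ln ((1 - c) + c * X \<omega> / \<mu>)) \<in> borel_measurable M"
    by measurable
  ultimately show ?thesis using Bochner_Integration.integrable_bound by blast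
qed

definition Bern :: "real \<Rightarrow> nat pmf" where
  "Bern \<nu> = map_pmf of_bool (bernoulli_pmf \<nu>)"

lemma pmf_Bern:
  assumes "0 \<le> \<nu>" "\<nu> \<le> 1"
  shows "pmf (Bern \<nu>) 1 = \<nu>" "pmf (Bern \<nu>) 0 = 1 - \<nu>"
proof -
  have inj: "inj (of_bool :: bool \<Rightarrow> nat)" by (auto simp: inj_on_def)
  show "pmf (Bern \<nu>) 1 = \<nu>" "pmf (Bern \<nu>) 0 = 1 - \<nu>"
    using pmf_map_inj'[OF inj, of "bernoulli_pmf \<nu>" True]
      pmf_map_inj'[OF inj, of "bernoulli_pmf \<nu>" False] assms
    by (simp_all add: Bern_def)
qed

(* The divergence from Q to P. The library constant takes the logarithm base and then
   the reference measure Q before P. *)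
definition D_KL :: "'a pmf \<Rightarrow> 'a pmf \<Rightarrow> real" where
  "D_KL P Q = KL_divergence (exp 1) (measure_pmf Q) (measure_pmf P)"

lemma D_KL_eq_sum:
  fixes P Q :: "'a :: countable pmf"
  assumes "finite (set_pmf P)" and "set_pmf P \<subseteq> set_pmf Q"
  shows "D_KL P Q = (\<Sum>x\<in>set_pmf P. pmf P x * ln (pmf P x / pmf Q x))"
proof -
  interpret sigma_finite_measure "count_space (UNIV :: 'a set)"
    by (rule sigma_finite_measure_count_space)
  have "D_KL P Q = (\<integral>x. pmf P x * log (exp 1) (pmf P x / pmf Q x) \<partial>count_space UNIV)"
    unfolding D_KL_def measure_pmf_eq_density
    by (rule KL_density_density) (use assms(2) in \<open>auto simp: AE_count_space pmf_eq_0_set_pmf\<close>)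
  also have "\<dots> = (\<Sum>x | pmf P x * log (exp 1) (pmf P x / pmf Q x) \<noteq> 0.
      pmf P x * log (exp 1) (pmf P x / pmf Q x))"
    by (subst lebesgue_integral_count_space_finite_support)
      (auto intro!: finite_subset[OF _ assms(1)] simp: set_pmf_eq)
  also have "\<dots> = (\<Sum>x\<in>set_pmf P. pmf P x * log (exp 1) (pmf P x / pmf Q x))"
    using assms(1) by (intro sum.mono_neutral_left) (auto simp: set_pmf_eq)
  finally show ?thesis by (simp add: log_def)
qed

end

theory Submission
  imports Defs
begin

text \<open>
  Up to an additive constant, \<open>ln (1 - c + c x / \<mu>)\<close> is \<open>ln (1 + k x)\<close> with
  \<open>k = c / ((1 - c) \<mu>)\<close>. Compare \<open>ln (1 + k x)\<close> with the quadratic polynomial in \<open>x\<close> that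
  agrees with it at \<open>0\<close> and to first order at \<open>\<tau>\<close>. The interpolation error increases with
  \<open>k\<close> and the coefficient of \<open>x\<^sup>2\<close> decreases with \<open>k\<close>. Since \<open>E X = E X\<^sub>0\<close>, \<open>E X\<^sup>2 \<le> E X\<^sub>0\<^sup>2\<close> and the
  interpolant is exact on the two values of \<open>X\<^sub>0\<close>, every increment of \<open>\<lambda>\<close> over an interval
  \<open>[c, d]\<close> is at least that of \<open>\<lambda>\<^sub>0\<close>. Taking \<open>c = 0\<close> gives \<open>\<lambda> \<ge> \<lambda>\<^sub>0\<close>, and taking \<open>d = c\<^sub>0\<close>, the
  unique maximiser of \<open>\<lambda>\<^sub>0\<close>, shows that \<open>\<lambda>\<close> has no maximum to the left of \<open>c\<^sub>0\<close>.
\<close>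

lemma (in prob_space) expectation_two_valued:
  fixes X h :: "_ \<Rightarrow> real"
  assumes [measurable]: "X \<in> borel_measurable M" "h \<in> borel_measurable borel"
    and "a \<noteq> b" and AE: "AE \<omega> in M. X \<omega> \<in> {a, b}"
  shows "expectation (\<lambda>\<omega>. h (X \<omega>)) =
    prob {\<omega> \<in> space M. X \<omega> = a} * h a + prob {\<omega> \<in> space M. X \<omega> = b} * h b"
proof -
  let ?A = "\<lambda>y. {\<omega> \<in> space M. X \<omega> = y}"
  have "expectation (\<lambda>\<omega>. h (X \<omega>)) =
      expectation (\<lambda>\<omega>. indicator (?A a) \<omega> * h a + indicator (?A b) \<omega> * h b)"
    by (intro integral_cong_AE) (use AE \<open>a \<noteq> b\<close> in \<open>auto simp: indicator_def\<close>)
  also have "\<dots> = expectation (\<lambda>\<omega>. indicator (?A a) \<omega> * h a) +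
      expectation (\<lambda>\<omega>. indicator (?A b) \<omega> * h b)"
    by (intro Bochner_Integration.integral_add integrable_mult_left)
      (auto simp: integrable_indicator_iff less_top[symmetric])
  finally show ?thesis by simp
qed

text \<open>\<open>interp_lin t k\<close> and \<open>interp_quad t k\<close> are the coefficients of
  \<open>x\<close> and \<open>x\<^sup>2\<close> in the Hermite interpolant of
  \<open>ln (1 + k * x)\<close>: value 0 at 0, and value \<open>ln (1 + k * t)\<close> with slope
  \<open>k / (1 + k * t)\<close> at \<open>t\<close>.\<close>

definition interp_lin :: "real \<Rightarrow> real \<Rightarrow> real" where
  "interp_lin t k = 2 * ln (1 + k * t) / t - k / (1 + k * t)"

definition interp_quad :: "real \<Rightarrow> real \<Rightarrow> real" where
  "interp_quad t k = (k / (1 + k * t) - ln (1 + k * t) / t) / t"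

lemma interp_exact:
  assumes "t \<noteq> 0"
  shows "interp_lin t k * t + interp_quad t k * t\<^sup>2 = ln (1 + k * t)"
proof -
  have "(2 * L / t - K) * t + (K - L / t) / t * t\<^sup>2 = L" for K L :: real
    using assms by (simp add: field_simps power2_eq_square)
  then show ?thesis unfolding interp_lin_def interp_quad_def .
qed

lemma has_derivative_interp_lin:
  assumes "t > 0" "k \<ge> 0"
  shows "(interp_lin t has_real_derivative 2 / (1 + k * t) - 1 / (1 + k * t)\<^sup>2) (at k)"
proof -
  have u: "1 + k * t > 0" using assms by (simp add: add_pos_nonneg)
  have "((\<lambda>k. 2 * ln (1 + k * t) / t - k / (1 + k * t)) has_real_derivative
      2 * (t / (1 + k * t)) / t - ((1 + k * t) - k * t) / (1 + k * t)\<^sup>2) (at k)"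
    using assms u by (auto intro!: derivative_eq_intros simp: power2_eq_square)
  then show ?thesis unfolding interp_lin_def [abs_def] using \<open>t > 0\<close> by simp
qed

lemma has_derivative_interp_quad:
  assumes "t > 0" "k \<ge> 0"
  shows "(interp_quad t has_real_derivative - k / (1 + k * t)\<^sup>2) (at k)"
proof -
  have u: "1 + k * t > 0" using assms by (simp add: add_pos_nonneg)
  have "((\<lambda>k. (k / (1 + k * t) - ln (1 + k * t) / t) / t) has_real_derivative
      (((1 + k * t) - k * t) / (1 + k * t)\<^sup>2 - t / (1 + k * t) / t) / t) (at k)"
    using assms u by (auto intro!: derivative_eq_intros simp: power2_eq_square)
  also have "(((1 + k * t) - k * t) / (1 + k * t)\<^sup>2 - t / (1 + k * t) / t) / t = - k / (1 + k * t)\<^sup>2"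
    using \<open>t > 0\<close> u by (simp add: divide_simps) (simp add: algebra_simps power2_eq_square)
  finally show ?thesis unfolding interp_quad_def [abs_def] .
qed

text \<open>The derivative in \<open>k\<close>, namely \<open>- k / (1 + k * t)\<^sup>2\<close>, is
  nonpositive. This sign later allows an upper bound on the second moment in place of its exact
  value.\<close>

lemma interp_quad_antimono:
  assumes "t > 0" "0 \<le> k" "k \<le> l"
  shows "interp_quad t l \<le> interp_quad t k"
proof (rule DERIV_nonpos_imp_nonincreasing[OF \<open>k \<le> l\<close>])
  fix s assume "k \<le> s" "s \<le> l"
  with assms show "\<exists>y. (interp_quad t has_real_derivative y) (at s) \<and> y \<le> 0"
    by (intro exI[of _ "- s / (1 + s * t)\<^sup>2"] conjI has_derivative_interp_quad) simp_all
qed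

text \<open>The error vanishes at 0 and, by tangency, doubly at \<open>t\<close>, for every
  \<open>k\<close>. Its derivative in \<open>k\<close> inherits these zeros, hence the factor
  \<open>x * (x - t)\<^sup>2\<close>, which is nonnegative for \<open>x \<ge> 0\<close>.\<close>

lemma interp_error_mono:
  assumes "t > 0" "x \<ge> 0" "0 \<le> k" "k \<le> l"
  shows "ln (1 + k * x) - (interp_lin t k * x + interp_quad t k * x\<^sup>2)
    \<le> ln (1 + l * x) - (interp_lin t l * x + interp_quad t l * x\<^sup>2)"
proof (rule DERIV_nonneg_imp_nondecreasing[OF \<open>k \<le> l\<close>])
  fix s assume "k \<le> s" "s \<le> l"
  with assms have "s \<ge> 0" by simp
  have t: "1 + s * t > 0" and x: "1 + s * x > 0"
    using assms \<open>s \<ge> 0\<close> by (simp_all add: add_pos_nonneg)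
  have "((\<lambda>s. ln (1 + s * x) - (interp_lin t s * x + interp_quad t s * x\<^sup>2)) has_real_derivative
      x / (1 + s * x) - ((2 / (1 + s * t) - 1 / (1 + s * t)\<^sup>2) * x + (- s / (1 + s * t)\<^sup>2) * x\<^sup>2)) (at s)"
    using x by (auto intro!: derivative_eq_intros has_derivative_interp_lin
      has_derivative_interp_quad \<open>t > 0\<close> \<open>s \<ge> 0\<close>)
  also have "x / (1 + s * x) - ((2 / (1 + s * t) - 1 / (1 + s * t)\<^sup>2) * x + (- s / (1 + s * t)\<^sup>2) * x\<^sup>2)
      = s\<^sup>2 * x * (x - t)\<^sup>2 / ((1 + s * t)\<^sup>2 * (1 + s * x))"
    using t x by (simp add: divide_simps) (simp add: algebra_simps power2_eq_square)
  finally show "\<exists>y. ((\<lambda>s. ln (1 + s * x) - (interp_lin t s * x + interp_quad t s * x\<^sup>2))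
      has_real_derivative y) (at s) \<and> y \<ge> 0"
    using x \<open>x \<ge> 0\<close> by (intro exI[of _ "s\<^sup>2 * x * (x - t)\<^sup>2 / ((1 + s * t)\<^sup>2 * (1 + s * x))"]) simp
qed

lemma ln_affine_eq:
  fixes c \<mu> x :: real
  assumes "0 \<le> c" "c < 1" "\<mu> > 0" "x \<ge> 0"
  shows "ln (1 - c + c * x / \<mu>) = ln (1 - c) + ln (1 + c / ((1 - c) * \<mu>) * x)"
proof -
  have "1 - c + c * x / \<mu> = (1 - c) * (1 + c / ((1 - c) * \<mu>) * x)"
    using assms by (simp add: field_simps)
  moreover have "1 + c / ((1 - c) * \<mu>) * x > 0"
    using assms by (intro add_pos_nonneg) auto
  ultimately show ?thesis using assms by (simp add: ln_mult_pos)
qed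

text \<open>The right-hand side below is the increment of \<open>log_growth\<close> for the two-valued variable.\<close>

lemma log_growth_increment_ge:
  fixes X :: "'a \<Rightarrow> real"
  assumes "prob_space M" and AE: "AE \<omega> in M. X \<omega> \<ge> 0"
    and X: "integrable M X" and X2: "integrable M (\<lambda>\<omega>. (X \<omega>)\<^sup>2)"
    and mean: "prob_space.expectation M X = \<theta>"
    and second: "prob_space.expectation M (\<lambda>\<omega>. (X \<omega>)\<^sup>2) \<le> \<theta> * \<tau>"
    and \<mu>: "\<mu> > 0" and \<tau>: "\<tau> > 0" and c: "0 \<le> c" "c \<le> d" "d < 1"
  shows "log_growth M X \<mu> d - log_growth M X \<mu> c \<ge>
    (1 - \<theta> / \<tau>) * (ln (1 - d) - ln (1 - c)) +
    \<theta> / \<tau> * (ln (1 - d + d * \<tau> / \<mu>) - ln (1 - c + c * \<tau> / \<mu>))"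
proof -
  interpret prob_space M by fact
  define k l where "k = c / ((1 - c) * \<mu>)" and "l = d / ((1 - d) * \<mu>)"
  define A B where "A = interp_lin \<tau> l - interp_lin \<tau> k"
    and "B = interp_quad \<tau> l - interp_quad \<tau> k"
  define L where "L = ln (1 - d) - ln (1 - c)"
  have kl: "0 \<le> k" "k \<le> l"
    unfolding k_def l_def using c \<mu> by (auto intro!: frac_le mult_right_mono)
  have ln_c: "ln (1 - c + c * x / \<mu>) = ln (1 - c) + ln (1 + k * x)"
    and ln_d: "ln (1 - d + d * x / \<mu>) = ln (1 - d) + ln (1 + l * x)" if "x \<ge> 0" for x
    using that c \<mu> ln_affine_eq[of c \<mu> x] ln_affine_eq[of d \<mu> x] by (simp_all add: k_def l_def)
  have B: "B \<le> 0" unfolding B_def using interp_quad_antimono[OF \<tau> kl] by simp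
  have AB: "A * \<tau> + B * \<tau>\<^sup>2 = ln (1 + l * \<tau>) - ln (1 + k * \<tau>)"
    unfolding A_def B_def using \<tau> interp_exact[of \<tau> k] interp_exact[of \<tau> l]
    by (simp add: left_diff_distrib)
  have int: "integrable M (\<lambda>\<omega>. ln (1 - e + e * X \<omega> / \<mu>))" if "0 \<le> e" "e < 1" for e
    using log_growth_integrable[OF prob_space_axioms X AE \<mu> that] .
  have "expectation (\<lambda>\<omega>. L + A * X \<omega> + B * (X \<omega>)\<^sup>2)
      \<le> expectation (\<lambda>\<omega>. ln (1 - d + d * X \<omega> / \<mu>) - ln (1 - c + c * X \<omega> / \<mu>))"
  proof (rule integral_mono_AE)
    show "AE \<omega> in M. L + A * X \<omega> + B * (X \<omega>)\<^sup>2
        \<le> ln (1 - d + d * X \<omega> / \<mu>) - ln (1 - c + c * X \<omega> / \<mu>)"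
      using AE
    proof eventually_elim
      case (elim \<omega>)
      show ?case using interp_error_mono[OF \<tau> elim kl] ln_c[OF elim] ln_d[OF elim]
        by (simp add: A_def B_def L_def left_diff_distrib)
    qed
  qed (use X X2 int c in auto)
  also have "\<dots> = log_growth M X \<mu> d - log_growth M X \<mu> c"
    unfolding log_growth_def using int c by simp
  finally have "L + A * \<theta> + B * expectation (\<lambda>\<omega>. (X \<omega>)\<^sup>2)
      \<le> log_growth M X \<mu> d - log_growth M X \<mu> c"
    using X X2 mean by (simp add: prob_space)
  \<comment> \<open>As \<open>B\<close> is nonpositive, raising the second moment to its bound can
    only lower the left-hand side.\<close>
  moreover have "B * (\<theta> * \<tau>) \<le> B * expectation (\<lambda>\<omega>. (X \<omega>)\<^sup>2)"
    using second B by (rule mult_left_mono_neg)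
  \<comment> \<open>\<open>\<theta>\<close> and \<open>\<theta> * \<tau>\<close> are the first two
    moments of the law with weight \<open>\<theta> / \<tau>\<close> at \<open>\<tau>\<close> and the
    rest at 0, where the quadratic without \<open>L\<close> vanishes.\<close>
  moreover have "A * \<theta> + B * (\<theta> * \<tau>) = \<theta> / \<tau> * (A * \<tau> + B * \<tau>\<^sup>2)"
    using \<tau> by (simp add: field_simps power2_eq_square)
  ultimately have "L + \<theta> / \<tau> * (ln (1 + l * \<tau>) - ln (1 + k * \<tau>))
      \<le> log_growth M X \<mu> d - log_growth M X \<mu> c"
    unfolding AB by linarith
  then show ?thesis using ln_c[of \<tau>] ln_d[of \<tau>] \<tau> by (simp add: L_def algebra_simps)
qed

text \<open>The tangent to the strictly concave logarithm at 1 touches it only there. Strictness is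
  what will make \<open>c\<^sub>0\<close> the only maximiser.\<close>

lemma ln_less_minus_one:
  fixes x :: real
  assumes "x > 0" "x \<noteq> 1"
  shows "ln x < x - 1"
  using ln_le_minus_one[of x] ln_eq_minus_one[of x] assms by fastforce

text \<open>
  Gibbs' inequality: under the probability \<open>\<mu> / \<tau>\<close> of \<open>\<tau>\<close> the growth factor \<open>1 - c + c X / \<mu>\<close>
  has mean \<open>1\<close>, so the factors at \<open>c\<close> reweight this distribution to another one,
  which gives \<open>\<tau>\<close> the probability \<open>\<theta> / \<tau>\<close> exactly for \<open>c = c\<^sub>0\<close>.
\<close>

lemma two_point_growth_less:
  fixes \<mu> \<theta> \<tau> c :: real
  assumes "0 < \<mu>" "\<mu> < \<theta>" "\<theta> < \<tau>" "0 \<le> c" "c < 1" "c \<noteq> (\<theta> - \<mu>) / (\<tau> - \<mu>)"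
  shows "(1 - \<theta> / \<tau>) * ln (1 - c) + \<theta> / \<tau> * ln (1 - c + c * \<tau> / \<mu>)
    < (1 - \<theta> / \<tau>) * ln ((\<tau> - \<theta>) / (\<tau> - \<mu>)) + \<theta> / \<tau> * ln (\<theta> / \<mu>)"
proof -
  \<comment> \<open>The growth factors at \<open>c\<close> on the values 0 and
    \<open>\<tau>\<close>, relative to those at
    \<open>(\<theta> - \<mu>) / (\<tau> - \<mu>)\<close>. The claim is that the weighted mean of
    \<open>ln a\<close> and \<open>ln b\<close> is negative.\<close>
  define a b where "a = (1 - c) / ((\<tau> - \<theta>) / (\<tau> - \<mu>))" and "b = (1 - c + c * \<tau> / \<mu>) / (\<theta> / \<mu>)"
  have pos: "0 < 1 - c + c * \<tau> / \<mu>" using assms by (intro add_pos_nonneg) auto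
  have a: "a > 0" "a \<noteq> 1"
    unfolding a_def using assms by (simp_all add: divide_simps) (simp add: algebra_simps)
  have b: "b > 0" unfolding b_def using assms pos by simp
  \<comment> \<open>Dividing by the reference factors turns the weights
    \<open>1 - \<theta> / \<tau>\<close>, \<open>\<theta> / \<tau>\<close> into
    \<open>1 - \<mu> / \<tau>\<close>, \<open>\<mu> / \<tau>\<close>, under which the growth factor
    at \<open>c\<close> has mean 1.\<close>
  have "(1 - \<theta> / \<tau>) * (a - 1) + \<theta> / \<tau> * (b - 1) = 0"
    unfolding a_def b_def using assms by (simp add: divide_simps) (simp add: algebra_simps)
  moreover have "(1 - \<theta> / \<tau>) * ln a < (1 - \<theta> / \<tau>) * (a - 1)"
    using a assms by (intro mult_strict_left_mono ln_less_minus_one) auto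
  moreover have "\<theta> / \<tau> * ln b \<le> \<theta> / \<tau> * (b - 1)"
    using b assms by (intro mult_left_mono ln_le_minus_one) auto
  moreover have "ln a = ln (1 - c) - ln ((\<tau> - \<theta>) / (\<tau> - \<mu>))"
    unfolding a_def using assms by (intro ln_divide_pos) auto
  moreover have "ln b = ln (1 - c + c * \<tau> / \<mu>) - ln (\<theta> / \<mu>)"
    unfolding b_def using assms pos by (intro ln_divide_pos) auto
  ultimately show ?thesis by (simp add: right_diff_distrib)
qed

lemma set_pmf_Bern:
  assumes "0 < \<nu>" "\<nu> < 1"
  shows "set_pmf (Bern \<nu>) = {0, 1}"
  using assms by (auto simp: Bern_def UNIV_bool)

text \<open>Strict bounds give both distributions the full support, so the divergence is a finite
  sum of two terms.\<close>

lemma D_KL_Bern: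
  assumes "0 < p" "p < 1" "0 < q" "q < 1"
  shows "D_KL (Bern p) (Bern q) = (1 - p) * ln ((1 - p) / (1 - q)) + p * ln (p / q)"
  using assms by (subst D_KL_eq_sum) (simp_all add: set_pmf_Bern pmf_Bern pmf_Bern(1)[simplified])

theorem theorem8:
  fixes \<mu> \<theta> \<sigma> \<tau> c\<^sub>0 :: real and M\<^sub>0 :: "'a measure" and X\<^sub>0 :: "'a \<Rightarrow> real"
  assumes "\<mu> > 0" and "\<theta> > \<mu>" and "\<sigma>\<^sup>2 > 0"
    and "\<tau> = (\<theta>\<^sup>2 + \<sigma>\<^sup>2) / \<theta>"
    and "c\<^sub>0 = (\<theta> - \<mu>) / (\<tau> - \<mu>)"
    and "prob_space M\<^sub>0" and "X\<^sub>0 \<in> borel_measurable M\<^sub>0"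
    and "AE \<omega> in M\<^sub>0. X\<^sub>0 \<omega> \<in> {0, \<tau>}"
    and "measure M\<^sub>0 {\<omega> \<in> space M\<^sub>0. X\<^sub>0 \<omega> = \<tau>} = \<theta> / \<tau>"
    and "measure M\<^sub>0 {\<omega> \<in> space M\<^sub>0. X\<^sub>0 \<omega> = 0} = 1 - \<theta> / \<tau>"
  shows "prob_space.expectation M\<^sub>0 X\<^sub>0 = \<theta> \<and>
    prob_space.variance M\<^sub>0 X\<^sub>0 = \<sigma>\<^sup>2 \<and>
    (\<forall>c\<in>{0..<1}. log_growth M\<^sub>0 X\<^sub>0 \<mu> c =
       (1 - \<theta> / \<tau>) * ln (1 - c) + \<theta> / \<tau> * ln (1 - c + c * \<tau> / \<mu>)) \<and>
    is_arg_max (log_growth M\<^sub>0 X\<^sub>0 \<mu>) (\<lambda>c. c \<in> {0..<1}) c\<^sub>0 \<and>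
    log_growth M\<^sub>0 X\<^sub>0 \<mu> c\<^sub>0 =
       (1 - \<theta> / \<tau>) * ln ((\<tau> - \<theta>) / (\<tau> - \<mu>)) + \<theta> / \<tau> * ln (\<theta> / \<mu>) \<and>
    (1 - \<theta> / \<tau>) * ln ((\<tau> - \<theta>) / (\<tau> - \<mu>)) + \<theta> / \<tau> * ln (\<theta> / \<mu>) =
       D_KL (Bern (\<theta> / \<tau>)) (Bern (\<mu> / \<tau>)) \<and>
    (\<forall>(M :: 'b measure) X :: 'b \<Rightarrow> real.
       prob_space M \<and> X \<in> borel_measurable M \<and> (AE \<omega> in M. X \<omega> \<ge> 0) \<and>
       integrable M X \<and> integrable M (\<lambda>\<omega>. (X \<omega>)\<^sup>2) \<and>
       prob_space.expectation M X = \<theta> \<and> prob_space.variance M X \<le> \<sigma>\<^sup>2 \<longrightarrow>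
       (\<forall>c\<in>{0..<1}. log_growth M X \<mu> c \<ge> log_growth M\<^sub>0 X\<^sub>0 \<mu> c) \<and>
       (\<forall>c_opt. is_arg_max (log_growth M X \<mu>) (\<lambda>c. c \<in> {0..<1}) c_opt \<longrightarrow> c_opt \<ge> c\<^sub>0))"
proof -
  note \<mu> = assms(1) and \<theta> = assms(2) and \<tau>_eq = assms(4) and c0_eq = assms(5)
  interpret M0: prob_space M\<^sub>0 by (rule assms(6))
  have "\<theta> > 0" using \<mu> \<theta> by simp
  then have \<theta>\<tau>: "\<theta> * \<tau> = \<theta>\<^sup>2 + \<sigma>\<^sup>2" by (simp add: \<tau>_eq)
  then have "\<theta> * \<theta> < \<theta> * \<tau>" using assms(3) by (simp add: power2_eq_square)
  with \<open>\<theta> > 0\<close> have "\<theta> < \<tau>" by simp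
  with \<open>\<theta> > 0\<close> have \<tau>: "\<tau> > 0" by simp
  have E0: "M0.expectation (\<lambda>\<omega>. h (X\<^sub>0 \<omega>)) = (1 - \<theta> / \<tau>) * h 0 + \<theta> / \<tau> * h \<tau>"
    if "h \<in> borel_measurable borel" for h :: "real \<Rightarrow> real"
    using M0.expectation_two_valued[OF assms(7) that _ assms(8)] \<tau> assms(9,10) by simp
  have mean: "M0.expectation X\<^sub>0 = \<theta>" using E0[of "\<lambda>x. x"] \<tau> by simp
  have "M0.variance X\<^sub>0 = (1 - \<theta> / \<tau>) * \<theta>\<^sup>2 + \<theta> / \<tau> * (\<tau> - \<theta>)\<^sup>2"
    unfolding mean using E0[of "\<lambda>x. (x - \<theta>)\<^sup>2"] by simp
  also have "\<dots> = \<theta> * \<tau> - \<theta>\<^sup>2"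
    using \<tau> by (simp add: field_simps power2_eq_square)
  finally have var: "M0.variance X\<^sub>0 = \<sigma>\<^sup>2" using \<theta>\<tau> by simp
  have growth0: "log_growth M\<^sub>0 X\<^sub>0 \<mu> c =
      (1 - \<theta> / \<tau>) * ln (1 - c) + \<theta> / \<tau> * ln (1 - c + c * \<tau> / \<mu>)" for c
    unfolding log_growth_def using E0[of "\<lambda>x. ln (1 - c + c * x / \<mu>)"] by simp
  have c0: "c\<^sub>0 \<in> {0..<1}" unfolding c0_eq using \<theta> \<open>\<theta> < \<tau>\<close> by simp
  \<comment> \<open>The growth factors at \<open>c\<^sub>0\<close> are the likelihood ratios of
    \<open>Bern (\<theta> / \<tau>)\<close> to \<open>Bern (\<mu> / \<tau>)\<close>, which is why
    the maximum is a divergence.\<close>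
  have "1 - c\<^sub>0 = (\<tau> - \<theta>) / (\<tau> - \<mu>)" "1 - c\<^sub>0 + c\<^sub>0 * \<tau> / \<mu> = \<theta> / \<mu>"
    unfolding c0_eq using \<mu> \<theta> \<open>\<theta> < \<tau>\<close>
    by (simp_all add: divide_simps) (simp_all add: algebra_simps)
  then have max: "log_growth M\<^sub>0 X\<^sub>0 \<mu> c\<^sub>0 =
      (1 - \<theta> / \<tau>) * ln ((\<tau> - \<theta>) / (\<tau> - \<mu>)) + \<theta> / \<tau> * ln (\<theta> / \<mu>)"
    unfolding growth0 by simp
  have less: "log_growth M\<^sub>0 X\<^sub>0 \<mu> c < log_growth M\<^sub>0 X\<^sub>0 \<mu> c\<^sub>0" if "c \<in> {0..<1}" "c \<noteq> c\<^sub>0" for c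
    unfolding max unfolding growth0
    using that c0_eq \<mu> \<theta> \<open>\<theta> < \<tau>\<close> by (intro two_point_growth_less) auto
  have argmax: "is_arg_max (log_growth M\<^sub>0 X\<^sub>0 \<mu>) (\<lambda>c. c \<in> {0..<1}) c\<^sub>0"
    unfolding is_arg_max_def using c0 less less_asym by blast
  have "(1 - \<theta> / \<tau>) / (1 - \<mu> / \<tau>) = (\<tau> - \<theta>) / (\<tau> - \<mu>)" "\<theta> / \<tau> / (\<mu> / \<tau>) = \<theta> / \<mu>"
    using \<tau> by (simp_all add: divide_simps)
  then have KL: "(1 - \<theta> / \<tau>) * ln ((\<tau> - \<theta>) / (\<tau> - \<mu>)) + \<theta> / \<tau> * ln (\<theta> / \<mu>) =
      D_KL (Bern (\<theta> / \<tau>)) (Bern (\<mu> / \<tau>))"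
    using \<mu> \<theta> \<tau> \<open>\<theta> < \<tau>\<close> by (subst D_KL_Bern) simp_all
  have dominated: "(\<forall>c\<in>{0..<1}. log_growth M X \<mu> c \<ge> log_growth M\<^sub>0 X\<^sub>0 \<mu> c) \<and>
      (\<forall>c_opt. is_arg_max (log_growth M X \<mu>) (\<lambda>c. c \<in> {0..<1}) c_opt \<longrightarrow> c_opt \<ge> c\<^sub>0)"
    if H: "prob_space M \<and> X \<in> borel_measurable M \<and> (AE \<omega> in M. X \<omega> \<ge> 0) \<and>
       integrable M X \<and> integrable M (\<lambda>\<omega>. (X \<omega>)\<^sup>2) \<and>
       prob_space.expectation M X = \<theta> \<and> prob_space.variance M X \<le> \<sigma>\<^sup>2"
    for M :: "'b measure" and X :: "'b \<Rightarrow> real"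
  proof -
    interpret prob_space M using H by blast
    \<comment> \<open>The choice of \<open>\<tau>\<close> makes
      \<open>\<theta> * \<tau> = \<theta>\<^sup>2 + \<sigma>\<^sup>2\<close> the second moment of
      \<open>X\<^sub>0\<close>, so the variance bound compares second moments.\<close>
    have "variance X = expectation (\<lambda>\<omega>. (X \<omega>)\<^sup>2) - \<theta>\<^sup>2" using H variance_eq[of X] by metis
    then have second: "expectation (\<lambda>\<omega>. (X \<omega>)\<^sup>2) \<le> \<theta> * \<tau>"
      using H \<theta>\<tau> by linarith
    have inc: "log_growth M\<^sub>0 X\<^sub>0 \<mu> d - log_growth M\<^sub>0 X\<^sub>0 \<mu> c
        \<le> log_growth M X \<mu> d - log_growth M X \<mu> c" if "0 \<le> c" "c \<le> d" "d < 1" for c d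
      using log_growth_increment_ge[OF prob_space_axioms _ _ _ _ second \<mu> \<tau> that] H
      unfolding growth0 by (simp add: right_diff_distrib)
    show ?thesis
    proof (intro conjI ballI allI impI)
      fix c :: real assume "c \<in> {0..<1}"
      \<comment> \<open>Both growth rates are 0 at 0, since \<open>ln 1 = 0\<close>, so the
        increments from 0 are the rates themselves.\<close>
      then show "log_growth M\<^sub>0 X\<^sub>0 \<mu> c \<le> log_growth M X \<mu> c"
        using inc[of 0 c] by (simp add: log_growth_def)
    next
      fix c assume c: "is_arg_max (log_growth M X \<mu>) (\<lambda>c. c \<in> {0..<1}) c"
      show "c\<^sub>0 \<le> c"
      proof (rule ccontr)
        assume "\<not> c\<^sub>0 \<le> c"
        \<comment> \<open>The increment for \<open>X\<close> over \<open>[c, c\<^sub>0]\<close> is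
          at least the one for \<open>X\<^sub>0\<close>, which is positive because
          \<open>c\<^sub>0\<close> is the unique maximiser there.\<close>
        then have "log_growth M X \<mu> c < log_growth M X \<mu> c\<^sub>0"
          using inc[of c c\<^sub>0] less[of c] c c0 by (auto simp: is_arg_max_def)
        with c c0 show False by (auto simp: is_arg_max_def)
      qed
    qed
  qed
  show ?thesis using mean var growth0 argmax max KL dominated by blast
qed

end
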